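(* Let $L>0$, $p^*\in(0,1)$, $0<\delta_{MIN}\le\delta_{MAX}$, and $0<V_{MIN}\le V_{MAX}$ be such that $$V_{MAX}\ \ge\ \frac{L(1-p^* )}{p^*\,\delta_{MIN}}\qquad\text{and}\qquad V_{MIN}\ \le\ \frac{L(1-p^* )}{p^*\,\delta_{MAX}}.$$ Then there exists a causal velocity profile $(V_j)_{j\ge1}$ with values in $[V_{MIN},V_{MAX}]$ such that, for every first arrival time $t_1>0$ and every sequence of gaps $(\delta_k)_{k\ge1}$ with $\delta_{MIN}\le\delta_k\le\delta_{MAX}$, the coverage ratio $p(t)$ of the cell satisfies $$\lim_{t\to\infty}p(t)=p^*.$$
   Context: Fix a cell (small region) over which drones fly one at a time; $L$ is the length of the part of the trajectories inside the cell. The $k$-th drone to visit the cell ($k=1,2,\dots$) arrives at time $t_{2k-1}$, crosses the cell at speed $V_k\in[V_{MIN},V_{MAX}]$, and leaves at time $t_{2k}$. Thus $t_{2k}-t_{2k-1}=\Delta_k:=L/V_k$, and $\delta_k:=t_{2k+1}-t_{2k}$ is the gap until the next arrival. It is assumed that $0<\delta_{MIN}\le\delta_k\le\delta_{MAX}$ for all $k$. For $t>0$, $c(t)$ is the total time in $[0,t]$ during which a drone is over the cell, i.e. the Lebesgue measure of $[0,t]\cap\bigcup_k[t_{2k-1},t_{2k}]$, and $p(t)=c(t)/t$ is the coverage ratio. A causal velocity profile is a rule determining each $V_j$ only from the past data up to time $t_{2j-1}$, i.e. as a function of $t_1,\dots,t_{2j-1}$ and $V_1,\dots,V_{j-1}$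 (and the fixed constants $L,p^*,\delta_{MIN},\delta_{MAX},V_{MIN},V_{MAX}$). *)

theory Defs
  imports "HOL-Analysis.Analysis"
begin

text \<open>
  A causal velocity profile is a function \<open>\<phi>\<close> of two lists, the past event times and the past
  speeds: the speed of the \<open>k\<close>-th drone is \<open>\<phi> [t\<^sub>1, \<dots>, t\<^bsub>2k-1\<^esub>] [V\<^sub>1, \<dots>, V\<^bsub>k-1\<^esub>]\<close>.
\<close>

type_synonym velocity_profile = "real list \<Rightarrow> real list \<Rightarrow> real"

text \<open>
  The event times \<open>t\<^sub>i\<close> and speeds \<open>V\<^sub>k\<close> generated by the profile \<open>\<phi>\<close>, the first arrival time
  \<open>t\<^sub>1\<close> and the gaps \<open>\<delta>\<close>. All indices start at 1; the values at index 0 are junk.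
\<close>

function (sequential)
  event_time :: "real \<Rightarrow> velocity_profile \<Rightarrow> real \<Rightarrow> (nat \<Rightarrow> real) \<Rightarrow> nat \<Rightarrow> real" and
  speed :: "real \<Rightarrow> velocity_profile \<Rightarrow> real \<Rightarrow> (nat \<Rightarrow> real) \<Rightarrow> nat \<Rightarrow> real"
where
  "event_time L \<phi> t1 \<delta> i =
     (if i \<le> 1 then t1
      else if even i then event_time L \<phi> t1 \<delta> (i - 1) + L / speed L \<phi> t1 \<delta> (i div 2)
      else event_time L \<phi> t1 \<delta> (i - 1) + \<delta> (i div 2))"
| "speed L \<phi> t1 \<delta> k =
     \<phi> (map (event_time L \<phi> t1 \<delta>) [1..<2 * k]) (map (speed L \<phi> t1 \<delta>) [1..<k])"
  by pat_completeness auto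
termination
  by (relation "Wellfounded.measure (\<lambda>x. case x of Inl (L, \<phi>, t1, \<delta>, i) \<Rightarrow> 2 * i
                                     | Inr (L, \<phi>, t1, \<delta>, k) \<Rightarrow> 4 * k - 1)") auto

declare event_time.simps [simp del] speed.simps [simp del]

lemma event_time_1: "event_time L \<phi> t1 \<delta> 1 = t1"
  by (simp add: event_time.simps)

lemma event_time_even:
  "k \<ge> 1 \<Longrightarrow> event_time L \<phi> t1 \<delta> (2 * k) - event_time L \<phi> t1 \<delta> (2 * k - 1) = L / speed L \<phi> t1 \<delta> k"
  by (subst event_time.simps) auto

lemma event_time_odd:
  "k \<ge> 1 \<Longrightarrow> event_time L \<phi> t1 \<delta> (2 * k + 1) - event_time L \<phi> t1 \<delta> (2 * k) = \<delta> k"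
  by (subst event_time.simps) auto

definition coverage_time :: "(nat \<Rightarrow> real) \<Rightarrow> real \<Rightarrow> real" where
  "coverage_time t T = measure lebesgue ({0..T} \<inter> (\<Union>k\<in>{1..}. {t (2 * k - 1)..t (2 * k)}))"

definition coverage_ratio :: "(nat \<Rightarrow> real) \<Rightarrow> real \<Rightarrow> real" where
  "coverage_ratio t T = coverage_time t T / T"

end

theory Submission imports Defs begin

text \<open>
  Let the speed of each drone be such that its crossing time is \<open>p\<^sup>* / (1 - p\<^sup>*)\<close> times the gap
  that has just been observed; the two hypotheses say that this speed is admissible. Each gap
  together with the crossing after it is then covered in the ratio \<open>p\<^sup>*\<close> exactly, so
  \<open>c t - p\<^sup>* t\<close> takes the same value at all departure times. As \<open>c\<close> is increasing and
  1-Lipschitz and departure times have bounded distance, \<open>c t - p\<^sup>* t\<close> is bounded.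
\<close>

text \<open>
  The first drone has seen no gap: the difference below is then \<open>0\<close>, and so is the quotient,
  which makes its speed \<open>Vmin\<close>.
\<close>

definition last_gap_profile :: "real \<Rightarrow> real \<Rightarrow> real \<Rightarrow> real \<Rightarrow> velocity_profile" where
  "last_gap_profile L p Vmin Vmax ts vs =
     max Vmin (min Vmax (L * (1 - p) / (p * (ts ! (length ts - 1) - ts ! (length ts - 2)))))"

text \<open>The clamping by \<open>max\<close> and \<open>min\<close> secures the range on all pairs
  of lists, including those that are no flight history.\<close>

lemma last_gap_profile_bounds:
  "Vmin \<le> Vmax \<Longrightarrow> last_gap_profile L p Vmin Vmax ts vs \<in> {Vmin..Vmax}"
  by (auto simp: last_gap_profile_def)

text \<open>From the second drone on, the last two recorded times are a departure and the next
  arrival, so their difference is a true gap.\<close>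

lemma speed_last_gap_profile:
  assumes "k \<ge> 2"
  shows "speed L (last_gap_profile L p Vmin Vmax) t1 \<delta> k
       = max Vmin (min Vmax (L * (1 - p) / (p * \<delta> (k - 1))))"
proof -
  let ?t = "event_time L (last_gap_profile L p Vmin Vmax) t1 \<delta>"
  have "?t (2 * k - 1) - ?t (2 * k - 2) = \<delta> (k - 1)"
  proof -
    have "2 * k - 1 = 2 * (k - 1) + 1" "2 * k - 2 = 2 * (k - 1)" using assms by auto
    then show ?thesis using assms event_time_odd[of "k - 1"] by (simp only:)
  qed
  \<comment> \<open>List positions count from 0 and event times from 1: position \<open>n\<close> of
    the history of length \<open>2 * k - 1\<close> holds event time \<open>1 + n\<close>.\<close>
  moreover have "1 + (2 * k - 1 - 1) = 2 * k - 1" "1 + (2 * k - 1 - 2) = 2 * k - 2"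
    using assms by auto
  ultimately show ?thesis
    using assms by (subst speed.simps) (simp add: last_gap_profile_def del: One_nat_def)
qed

lemma coverage_time_mono:
  assumes "S \<le> T"
  shows "coverage_time t S \<le> coverage_time t T"
  unfolding coverage_time_def
  by (rule measure_mono_fmeasurable) (use assms in \<open>auto intro!: fmeasurable_Int_fmeasurable\<close>)

text \<open>Whatever is covered in \<open>{0..T}\<close> but not in \<open>{0..S}\<close> lies in
  \<open>{S..T}\<close>.\<close>

lemma coverage_time_lipschitz:
  assumes "S \<le> T"
  shows "coverage_time t T \<le> coverage_time t S + (T - S)"
proof -
  let ?U = "\<Union>k\<in>{1..}. {t (2 * k - 1)..t (2 * k)}"
  have S: "{0..S} \<inter> ?U \<in> lmeasurable"
    by (auto intro!: fmeasurable_Int_fmeasurable)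
  have "measure lebesgue ({0..T} \<inter> ?U) \<le> measure lebesgue (({0..S} \<inter> ?U) \<union> {S..T})"
    by (rule measure_mono_fmeasurable)
      (use S in \<open>auto intro!: fmeasurable.Un fmeasurable_Int_fmeasurable\<close>)
  also have "\<dots> \<le> measure lebesgue ({0..S} \<inter> ?U) + measure lebesgue {S..T}"
    by (rule measure_Un_le) (use S in auto)
  finally show ?thesis
    using assms by (simp add: coverage_time_def)
qed

text \<open>Cutting at a departure splits no crossing: the first \<open>k\<close> lie wholly inside,
  all later ones wholly outside, and they are pairwise disjoint. Positivity of \<open>t 1\<close>
  keeps the cut at 0 harmless.\<close>

lemma coverage_time_departure:
  fixes t :: "nat \<Rightarrow> real"
  assumes t: "strict_mono_on {1..} t" and "t 1 > 0" and k: "k \<ge> 1"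
  shows "coverage_time t (t (2 * k)) = (\<Sum>j=1..k. t (2 * j) - t (2 * j - 1))"
proof -
  have le: "t i \<le> t j \<longleftrightarrow> i \<le> j" if "i \<ge> 1" "j \<ge> 1" for i j
    using strict_mono_on_less_eq[OF t] that by auto
  let ?I = "\<lambda>j. {t (2 * j - 1)..t (2 * j)}"
  have "{0..t (2 * k)} \<inter> (\<Union>j\<in>{1..}. ?I j) = (\<Union>j\<in>{1..k}. ?I j)" (is "?A = ?B")
  proof
    show "?A \<subseteq> ?B"
    proof
      fix x assume "x \<in> ?A"
      then obtain j where j: "j \<ge> 1" "x \<in> ?I j" "x \<le> t (2 * k)" by auto
      then have "t (2 * j - 1) \<le> t (2 * k)" by auto
      then have "2 * j - 1 \<le> 2 * k" using le[of "2 * j - 1" "2 * k"] j(1) k by simp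
      then have "j \<le> k" by simp
      then show "x \<in> ?B" using j by auto
    qed
    show "?B \<subseteq> ?A"
    proof
      fix x assume "x \<in> ?B"
      then obtain j where j: "1 \<le> j" "j \<le> k" "x \<in> ?I j" by auto
      then have "t 1 \<le> t (2 * j - 1)" "t (2 * j) \<le> t (2 * k)" using le by auto
      then show "x \<in> ?A" using j \<open>t 1 > 0\<close> by auto
    qed
  qed
  moreover have "measure lebesgue ?B = (\<Sum>j\<in>{1..k}. measure lebesgue (?I j))"
  proof (rule measure_finite_Union)
    have "?I i \<inter> ?I j = {}" if "1 \<le> i" "i < j" for i j
      using le[of "2 * j - 1" "2 * i"] that by auto
    then show "disjoint_family_on ?I {1..k}"
      unfolding disjoint_family_on_def by (metis Int_commute atLeastAtMost_iff linorder_neq_iff)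
  next
    show "emeasure lebesgue (?I j) \<noteq> \<infinity>" for j
      using emeasure_lborel_cbox_finite[of "t (2 * j - 1)" "t (2 * j)"] by (auto simp: cbox_interval)
  qed auto
  moreover have "measure lebesgue (?I j) = t (2 * j) - t (2 * j - 1)" if "j \<in> {1..k}" for j
    using le[of "2 * j - 1" "2 * j"] that by auto
  ultimately show ?thesis by (simp add: coverage_time_def)
qed

lemma tendsto_ratio_of_bounded_error:
  fixes c :: "real \<Rightarrow> real"
  assumes "\<forall>\<^sub>F T in at_top. \<bar>c T - p * T\<bar> \<le> B"
  shows "((\<lambda>T. c T / T) \<longlongrightarrow> p) at_top"
proof -
  have "((\<lambda>T. c T / T - p) \<longlongrightarrow> 0) at_top"
  proof (rule Lim_null_comparison)
    show "\<forall>\<^sub>F T in at_top. norm (c T / T - p) \<le> B / T"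
      using assms eventually_gt_at_top[of 0]
    proof eventually_elim
      case (elim T)
      then have "c T / T - p = (c T - p * T) / T" by (simp add: field_simps)
      then show ?case using elim by (simp add: divide_right_mono)
    qed
    show "((\<lambda>T. B / T) \<longlongrightarrow> 0) at_top"
      by (rule real_tendsto_divide_at_top[OF tendsto_const filterlim_ident])
  qed
  then show ?thesis by (simp add: LIM_zero_iff)
qed

text \<open>The profile enters only through \<open>crossing\<close>. The first crossing may have any
  positive length, as it affects only the constant \<open>K\<close> below.\<close>

lemma coverage_ratio_tendsto:
  fixes t :: "nat \<Rightarrow> real"
  assumes p: "0 < p" "p < 1"
    and "t 1 > 0" and "t 1 < t 2" and "0 < \<delta>min"
    and gap: "\<And>k. k \<ge> 1 \<Longrightarrow> t (2 * k + 1) - t (2 * k) \<in> {\<delta>min..\<delta>max}"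
    and crossing: "\<And>k. k \<ge> 1 \<Longrightarrow>
      t (2 * k + 2) - t (2 * k + 1) = p / (1 - p) * (t (2 * k + 1) - t (2 * k))"
  shows "(coverage_ratio t \<longlongrightarrow> p) at_top"
proof -
  have pos: "t (2 * k) < t (2 * k + 1)" "t (2 * k + 1) < t (2 * k + 2)" if "k \<ge> 1" for k
  proof -
    show *: "t (2 * k) < t (2 * k + 1)" using gap[OF that] \<open>0 < \<delta>min\<close> by auto
    show "t (2 * k + 1) < t (2 * k + 2)"
      using crossing[OF that] p * by (smt (verit) divide_pos_pos mult_pos_pos)
  qed
  have step: "t i < t (Suc i)" if "i \<ge> 1" for i
  proof (cases "even i")
    case True
    then obtain k where "i = 2 * k" by blast
    then show ?thesis using pos(1)[of k] that by auto
  next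
    case False
    then obtain k where "i = 2 * k + 1" using oddE by blast
    then show ?thesis using pos(2)[of k] \<open>t 1 < t 2\<close>
      by (cases "k = 0") (auto simp: numeral_2_eq_2)
  qed
  have "t i < t j" if "i < j" "i \<ge> 1" for i j
    using that by (induction rule: less_Suc_induct) (use step in \<open>auto intro: less_trans\<close>)
  then have mono: "strict_mono_on {1..} t" by (auto simp: strict_mono_on_def)
  define c where "c = coverage_time t"
  \<comment> \<open>The value of \<open>c T - p * T\<close> at the first departure, where
    \<open>c (t 2) = t 2 - t 1\<close>.\<close>
  define K where "K = (1 - p) * (t 2 - t 1) - p * t 1"
  have departure: "c (t (2 * k)) - p * t (2 * k) = K" if "k \<ge> 1" for k
    using that
  proof (induction k rule: dec_induct)
    case base
    show ?case
      using coverage_time_departure[OF mono \<open>t 1 > 0\<close>, of 1]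
      by (simp add: c_def K_def algebra_simps numeral_2_eq_2)
  next
    case (step k)
    have "c (t (2 * Suc k)) = c (t (2 * k)) + (t (2 * k + 2) - t (2 * k + 1))"
      using coverage_time_departure[OF mono \<open>t 1 > 0\<close>, of k]
        coverage_time_departure[OF mono \<open>t 1 > 0\<close>, of "Suc k"] step(1)
      by (simp add: c_def)
    \<comment> \<open>The crossing raises \<open>c T - p * T\<close> by the left side, and the gap
      before it lowers it by the right side.\<close>
    moreover have "(1 - p) * (t (2 * k + 2) - t (2 * k + 1)) = p * (t (2 * k + 1) - t (2 * k))"
      using crossing[OF step(1)] p by (simp add: field_simps)
    ultimately show ?case using step(3) by (simp add: algebra_simps)
  qed
  \<comment> \<open>The longest possible gap plus the crossing that follows it.\<close>
  define D where "D = \<delta>max + p / (1 - p) * \<delta>max"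
  have period: "t (2 * Suc k) - t (2 * k) \<in> {\<delta>min..D}" if "k \<ge> 1" for k
  proof -
    have "p / (1 - p) * (t (2 * k + 1) - t (2 * k)) \<le> p / (1 - p) * \<delta>max"
      using gap[OF that] p by (intro mult_left_mono) auto
    then show ?thesis using gap[OF that] pos[OF that] crossing[OF that] by (auto simp: D_def)
  qed
  have bound: "\<bar>c T - p * T\<bar> \<le> \<bar>K\<bar> + D" if T: "T \<ge> t 2" for T
  proof -
    \<comment> \<open>Departures are at least \<open>\<delta>min\<close> apart, hence unbounded, so
      some departure comes after \<open>T\<close>.\<close>
    have grow: "t 2 + real k * \<delta>min \<le> t (2 * Suc k)" for k
    proof (induction k)
      case (Suc k)
      then show ?case using period[of "Suc k"] by (auto simp: algebra_simps)
    qed auto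
    obtain n where "T - t 2 < real n * \<delta>min" using \<open>0 < \<delta>min\<close> reals_Archimedean3 by blast
    then have ex: "\<exists>n. T < t (2 * Suc n)" using grow[of n] by (intro exI[of _ n]) auto
    \<comment> \<open>Departure \<open>m\<close> is the last one up to time \<open>T\<close>:
      \<open>T \<ge> t 2\<close> excludes \<open>m = 0\<close>, and minimality at
      \<open>m - 1\<close> then gives \<open>t (2 * m) \<le> T\<close>.\<close>
    define m where "m = (LEAST n. T < t (2 * Suc n))"
    have m: "T < t (2 * Suc m)" unfolding m_def using ex by (rule LeastI_ex)
    then have "m \<ge> 1" using T by (cases m) (auto simp: numeral_2_eq_2)
    moreover have "t (2 * m) \<le> T"
      using \<open>m \<ge> 1\<close> not_less_Least[of "m - 1" "\<lambda>n. T < t (2 * Suc n)"] by (simp add: m_def)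
    ultimately have S: "t (2 * m) \<le> T" "T - t (2 * m) \<le> D"
      and K: "c (t (2 * m)) - p * t (2 * m) = K"
      using m period[of m] departure[of m] by auto
    \<comment> \<open>With \<open>s = T - t (2 * m)\<close>, the value
      \<open>c T - p * T - K\<close> lies between \<open>- p * s\<close> and
      \<open>(1 - p) * s\<close>, so its modulus is at most \<open>s \<le> D\<close>.\<close>
    have "c (t (2 * m)) \<le> c T" "c T \<le> c (t (2 * m)) + (T - t (2 * m))"
      using coverage_time_mono[OF S(1)] coverage_time_lipschitz[OF S(1)] by (auto simp: c_def)
    moreover have "0 \<le> p * (T - t (2 * m))" "p * (T - t (2 * m)) \<le> T - t (2 * m)"
      using p S(1) by (auto intro: mult_left_le_one_le)
    ultimately show ?thesis using K S(2) by (simp add: algebra_simps)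
  qed
  have "((\<lambda>T. c T / T) \<longlongrightarrow> p) at_top"
    by (rule tendsto_ratio_of_bounded_error[OF eventually_at_top_linorderI[OF bound]])
  then show ?thesis unfolding c_def coverage_ratio_def[abs_def] .
qed

theorem theorem2:
  fixes L pstar \<delta>min \<delta>max Vmin Vmax :: real
  assumes "L > 0"
    and "0 < pstar" and "pstar < 1"
    and "0 < \<delta>min" and "\<delta>min \<le> \<delta>max"
    and "0 < Vmin" and "Vmin \<le> Vmax"
    and "Vmax \<ge> L * (1 - pstar) / (pstar * \<delta>min)"
    and "Vmin \<le> L * (1 - pstar) / (pstar * \<delta>max)"
  shows "\<exists>\<phi> :: velocity_profile.
           (\<forall>ts vs. \<phi> ts vs \<in> {Vmin..Vmax}) \<and>
           (\<forall>(t1 :: real) (\<delta> :: nat \<Rightarrow> real).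
              t1 > 0 \<longrightarrow> (\<forall>k\<ge>1. \<delta> k \<in> {\<delta>min..\<delta>max}) \<longrightarrow>
              ((\<lambda>T. coverage_ratio (event_time L \<phi> t1 \<delta>) T) \<longlongrightarrow> pstar) at_top)"
proof (intro exI conjI allI impI)
  let ?\<phi> = "last_gap_profile L pstar Vmin Vmax"
  show range: "?\<phi> ts vs \<in> {Vmin..Vmax}" for ts vs
    by (rule last_gap_profile_bounds) fact
  fix t1 :: real and \<delta> :: "nat \<Rightarrow> real"
  assume "t1 > 0" and \<delta>: "\<forall>k\<ge>1. \<delta> k \<in> {\<delta>min..\<delta>max}"
  let ?t = "event_time L ?\<phi> t1 \<delta>"
  show "(coverage_ratio ?t \<longlongrightarrow> pstar) at_top"
  proof (rule coverage_ratio_tendsto)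
    show "?t 1 > 0" using \<open>t1 > 0\<close> by (simp only: event_time_1)
    have "speed L ?\<phi> t1 \<delta> 1 > 0"
      using range \<open>0 < Vmin\<close> by (subst speed.simps) (auto intro: less_le_trans)
    then show "?t 1 < ?t 2"
      using event_time_even[of 1 L ?\<phi> t1 \<delta>] divide_pos_pos[OF \<open>L > 0\<close>] by fastforce
  next
    fix k :: nat assume k: "k \<ge> 1"
    show "?t (2 * k + 1) - ?t (2 * k) \<in> {\<delta>min..\<delta>max}"
      unfolding event_time_odd[OF k] using \<delta> k by blast
    have \<delta>k: "\<delta>min \<le> \<delta> k" "\<delta> k \<le> \<delta>max" using \<delta> k by auto
    \<comment> \<open>The desired speed decreases in the gap, so the two hypotheses on
      \<open>Vmax\<close> and \<open>Vmin\<close>, which concern the extreme gaps, place it in the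
      admissible range for every gap; the clamping then leaves it unchanged.\<close>
    have "L * (1 - pstar) / (pstar * \<delta> k) \<le> L * (1 - pstar) / (pstar * \<delta>min)"
      "L * (1 - pstar) / (pstar * \<delta>max) \<le> L * (1 - pstar) / (pstar * \<delta> k)"
      using assms(1-5) \<delta>k by (intro divide_left_mono mult_left_mono mult_pos_pos; simp)+
    then have "speed L ?\<phi> t1 \<delta> (Suc k) = L * (1 - pstar) / (pstar * \<delta> k)"
      using speed_last_gap_profile[of "Suc k"] k assms(8,9) by simp
    then have "L / speed L ?\<phi> t1 \<delta> (Suc k) = pstar / (1 - pstar) * \<delta> k"
      using \<open>L > 0\<close> by simp
    then show "?t (2 * k + 2) - ?t (2 * k + 1) = pstar / (1 - pstar) * (?t (2 * k + 1) - ?t (2 * k))"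
      using event_time_even[of "Suc k" L ?\<phi> t1 \<delta>] event_time_odd[OF k, of L ?\<phi> t1 \<delta>] by simp
  qed (use assms in auto)
qed

end
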